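(* Let $\mathcal{X}$ and $\mathcal{R}$ be two conics in the projective plane that have four distinct points in common. Consider two lines $\mathsf{I}$ and $\mathsf{J}$ through two pairs of these points. Consider the two tangents to $\mathcal{R}$ at two points $P$ and $Q$ of $\mathcal{R}$, and intersect them with $\mathcal{X}$ in four points. Then there is a conic $\mathcal{C}$ through these four points of intersection of the two tangents with $\mathcal{X}$ that is simultaneously tangent to $\mathsf{I}$ and $\mathsf{J}$ and such that the touching points of $\mathcal{C}$ at $\mathsf{I}$ and $\mathsf{J}$ and the points $P$ and $Q$ are collinear.
   Context: The setting is the (real or complex) projective plane. The two pairs of points are complementary: one of the lines $\mathsf{I},\mathsf{J}$ passes through two of the four common points of $\mathcal{X}$ and $\mathcal{R}$, and the other passes through the remaining two. Each of the two tangents to $\mathcal{R}$ meets $\mathcal{X}$ in two points, giving four points in total. *)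

theory Defs
  imports "HOL-Analysis.Analysis"
begin

definition dot3 :: "'a::field ^ 3 \<Rightarrow> 'a ^ 3 \<Rightarrow> 'a" where
  "dot3 x y = (\<Sum>i\<in>UNIV. x $ i * y $ i)"

lemma dot3_scale_left: "dot3 (c *s x) y = c * dot3 x y"
  by (simp add: dot3_def sum_distrib_left mult.assoc)

lemma dot3_scale_right: "dot3 x (c *s y) = c * dot3 x y"
  by (simp add: dot3_def sum_distrib_left ac_simps)

definition proportional :: "'a::field ^ 3 \<Rightarrow> 'a ^ 3 \<Rightarrow> bool" where
  "proportional x y \<longleftrightarrow> x \<noteq> 0 \<and> y \<noteq> 0 \<and> (\<exists>c. c \<noteq> 0 \<and> y = c *s x)"

lemma proportional_part_equivp: "part_equivp (proportional :: 'a::field ^ 3 \<Rightarrow> _)"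
proof (rule part_equivpI)
  have "proportional (1 :: 'a ^ 3) 1"
    unfolding proportional_def by (auto simp: vec_eq_iff intro!: exI[of _ 1])
  then show "\<exists>x :: 'a ^ 3. proportional x x" by blast
  show "symp (proportional :: 'a ^ 3 \<Rightarrow> _)"
  proof (rule sympI)
    fix x y :: "'a ^ 3"
    assume "proportional x y"
    then obtain c where c: "x \<noteq> 0" "y \<noteq> 0" "c \<noteq> 0" "y = c *s x"
      by (auto simp: proportional_def)
    then have "x = inverse c *s y" by (simp add: vector_smult_assoc)
    with c show "proportional y x"
      unfolding proportional_def by (meson nonzero_imp_inverse_nonzero)
  qed
  show "transp (proportional :: 'a ^ 3 \<Rightarrow> _)"
  proof (rule transpI)
    fix x y z :: "'a ^ 3"
    assume "proportional x y" "proportional y z"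
    then obtain c d where "x \<noteq> 0" "z \<noteq> 0" "c \<noteq> 0" "d \<noteq> 0" "z = (d * c) *s x"
      by (auto simp: proportional_def vector_smult_assoc)
    then show "proportional x z"
      unfolding proportional_def by (metis mult_eq_0_iff)
  qed
qed

text \<open>Points of the projective plane over a field: nonzero homogeneous coordinate
  vectors up to nonzero scalars.\<close>

quotient_type (overloaded) 'a ppoint = "'a::field ^ 3" / partial: proportional
  by (rule proportional_part_equivp)

lift_definition on_line :: "'a::field ^ 3 \<Rightarrow> 'a ppoint \<Rightarrow> bool"
  is "\<lambda>a x. dot3 a x = 0"
  by (auto simp: proportional_def dot3_scale_right)

definition is_line :: "'a::field ppoint set \<Rightarrow> bool" where
  "is_line L \<longleftrightarrow> (\<exists>a. a \<noteq> 0 \<and> L = {P. on_line a P})"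

definition pcollinear :: "'a::field ppoint set \<Rightarrow> bool" where
  "pcollinear S \<longleftrightarrow> (\<exists>L. is_line L \<and> S \<subseteq> L)"

text \<open>A conic is given by a nonzero symmetric matrix; degenerate conics (line pairs, double
  lines) are included. Matrices rather than point sets are used because over the reals a
  degenerate conic is not determined by its points.\<close>

definition is_conic :: "'a::field ^ 3 ^ 3 \<Rightarrow> bool" where
  "is_conic M \<longleftrightarrow> M \<noteq> 0 \<and> transpose M = M"

lift_definition conjugate :: "'a::field ^ 3 ^ 3 \<Rightarrow> 'a ppoint \<Rightarrow> 'a ppoint \<Rightarrow> bool"
  is "\<lambda>M x y. dot3 x (M *v y) = 0"
  by (auto simp: proportional_def dot3_scale_left dot3_scale_right vector_scalar_commute)

definition conic_points :: "'a::field ^ 3 ^ 3 \<Rightarrow> 'a ppoint set" where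
  "conic_points M = {P. conjugate M P P}"

text \<open>Conjugate to every point means that the gradient \<open>M *v x\<close> of the form vanishes. On a
  nondegenerate conic every point is smooth.\<close>

definition smooth_point :: "'a::field ^ 3 ^ 3 \<Rightarrow> 'a ppoint \<Rightarrow> bool" where
  "smooth_point M P \<longleftrightarrow> P \<in> conic_points M \<and> (\<exists>Z. \<not> conjugate M Z P)"

text \<open>The line \<open>L\<close> touches the conic at \<open>T\<close>: it passes through \<open>T\<close> and is contained in the
  polar of \<open>T\<close>, i.e. the form restricted to \<open>L\<close> has (at least) a double zero at \<open>T\<close>. At a
  smooth point this holds for exactly one line, the polar of \<open>T\<close>; at a singular
  point of a degenerate conic it holds for every line through that point.\<close>

definition tangent_at :: "'a::field ^ 3 ^ 3 \<Rightarrow> 'a ppoint set \<Rightarrow> 'a ppoint \<Rightarrow> bool" where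
  "tangent_at M L T \<longleftrightarrow> is_line L \<and> T \<in> L \<and> (\<forall>Z\<in>L. conjugate M Z T)"

end

theory Submission
  imports Defs
begin

text \<open>Write \<open>X\<close>, \<open>R\<close> for the quadratic forms, \<open>I\<close>, \<open>J\<close>, \<open>p\<close>, \<open>q\<close>, \<open>l\<close> for linear forms of the
  lines, with \<open>l\<close> the line \<open>PQ\<close>. The line pair \<open>I J\<close> lies in the pencil of \<open>X\<close> and \<open>R\<close>, say
  \<open>k I J = \<alpha> X + \<beta> R\<close>, and since \<open>p\<close>, \<open>q\<close> touch \<open>R\<close> on \<open>l\<close> there is a relation
  \<open>2 r p q = r^2 R + \<delta> l^2\<close> with \<open>r \<noteq> 0\<close>. Eliminating \<open>R\<close> gives
  \<open>k r^2 I J + \<beta> \<delta> l^2 = \<alpha> r^2 X + 2 \<beta> r p q\<close>. The left side shows that this conic touches \<open>I\<close>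
  and \<open>J\<close> on \<open>l\<close>, the right side that it contains the common points of \<open>X\<close> and \<open>p q\<close>.\<close>

section \<open>Linear algebra in three dimensions\<close>

text \<open>For nonzero vectors, \<open>cross u v\<close> vanishes exactly when both represent the
  same point; otherwise it is the coefficient vector of the line joining them.\<close>

definition cross :: "'a::field ^ 3 \<Rightarrow> 'a ^ 3 \<Rightarrow> 'a ^ 3" where
  "cross u v = vector [u$2 * v$3 - u$3 * v$2, u$3 * v$1 - u$1 * v$3, u$1 * v$2 - u$2 * v$1]"

lemma dot3_expand: "dot3 x y = x$1 * y$1 + x$2 * y$2 + x$3 * y$3"
  by (simp add: dot3_def sum_3)

lemma dot3_commute: "dot3 x y = dot3 y x"
  by (simp add: dot3_expand mult.commute)

lemma dot3_add_left: "dot3 (x + y) z = dot3 x z + dot3 y z"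
  by (simp add: dot3_expand algebra_simps)

lemma dot3_add_right: "dot3 x (y + z) = dot3 x y + dot3 x z"
  by (simp add: dot3_expand algebra_simps)

lemma dot3_zero [simp]: "dot3 0 x = 0" "dot3 x 0 = 0"
  by (simp_all add: dot3_expand)

lemma dot3_nondegenerate:
  assumes "a \<noteq> 0"
  shows "\<exists>e. dot3 a e \<noteq> 0"
proof -
  obtain k where "a $ k \<noteq> 0"
    using assms by (auto simp: vec_eq_iff)
  moreover have "dot3 a (axis k 1) = a $ k"
    by (simp add: dot3_def axis_def if_distrib cong: if_cong)
  ultimately show ?thesis by metis
qed

lemma dot3_cross [simp]: "dot3 (cross u v) u = 0" "dot3 (cross u v) v = 0"
  by (simp_all add: dot3_expand cross_def algebra_simps)

lemma cross_eq_0_imp_multiple: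
  assumes "cross w x = 0" "w \<noteq> 0"
  shows "\<exists>c. x = c *s w"
proof -
  have e: "w$2 * x$3 = w$3 * x$2" "w$3 * x$1 = w$1 * x$3" "w$1 * x$2 = w$2 * x$1"
    using assms(1) by (simp_all add: cross_def vec_eq_iff forall_3)
  consider "w$1 \<noteq> 0" | "w$2 \<noteq> 0" | "w$3 \<noteq> 0"
    using assms(2) by (auto simp: vec_eq_iff forall_3)
  then show ?thesis
  proof cases
    case 1
    then have "x = (x$1 / w$1) *s w"
      using e by (simp add: vec_eq_iff forall_3 field_simps)
    then show ?thesis ..
  next
    case 2
    then have "x = (x$2 / w$2) *s w"
      using e by (simp add: vec_eq_iff forall_3 field_simps)
    then show ?thesis ..
  next
    case 3
    then have "x = (x$3 / w$3) *s w"
      using e by (simp add: vec_eq_iff forall_3 field_simps)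
    then show ?thesis ..
  qed
qed

text \<open>The triple product expansion shows that \<open>cross (cross u v) x\<close>
  vanishes.\<close>

lemma orthogonal_imp_multiple_cross:
  assumes "cross u v \<noteq> 0" "dot3 x u = 0" "dot3 x v = 0"
  shows "\<exists>c. x = c *s cross u v"
proof (rule cross_eq_0_imp_multiple[OF _ assms(1)])
  have "cross (cross u v) x = dot3 x u *s v - dot3 x v *s u"
    by (simp add: cross_def dot3_expand vec_eq_iff forall_3 algebra_simps)
  then show "cross (cross u v) x = 0"
    using assms by simp
qed

lemma orthogonal_imp_multiple:
  assumes "cross u v \<noteq> 0" "a \<noteq> 0" "dot3 a u = 0" "dot3 a v = 0"
    and "dot3 b u = 0" "dot3 b v = 0"
  shows "\<exists>c. b = c *s a"
proof -
  obtain c d where c: "a = c *s cross u v" and d: "b = d *s cross u v"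
    using orthogonal_imp_multiple_cross assms by metis
  with assms(2) have "b = (d / c) *s a"
    by (auto simp: vector_smult_assoc)
  then show ?thesis ..
qed

lemma orthogonal_imp_span:
  assumes "cross u v \<noteq> 0" "a \<noteq> 0" "dot3 a u = 0" "dot3 a v = 0" "dot3 a x = 0"
  shows "\<exists>s t. x = s *s u + t *s v"
proof -
  let ?w = "cross u v"
  obtain c where "a = c *s ?w"
    using orthogonal_imp_multiple_cross assms by metis
  with assms have x: "dot3 ?w x = 0"
    by (auto simp: dot3_scale_left)
  obtain e where e: "dot3 ?w e \<noteq> 0"
    using dot3_nondegenerate assms(1) by blast
  \<comment> \<open>Cramer's rule in the basis \<open>u\<close>, \<open>v\<close>, \<open>e\<close>,
    whose determinant is \<open>dot3 ?w e\<close>; the coefficient of \<open>e\<close> vanishes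
    because \<open>x\<close> lies on the line \<open>uv\<close>.\<close>
  have "dot3 ?w e *s x = dot3 (cross x v) e *s u + dot3 (cross u x) e *s v + dot3 ?w x *s e"
    by (simp add: cross_def dot3_expand vec_eq_iff forall_3 algebra_simps)
  then have "inverse (dot3 ?w e) *s (dot3 ?w e *s x)
      = inverse (dot3 ?w e) *s (dot3 (cross x v) e *s u + dot3 (cross u x) e *s v)"
    using x by simp
  then show ?thesis
    using e by (auto simp: vector_smult_assoc vector_add_ldistrib)
qed

text \<open>Any two lines meet. The zero row makes the matrix singular even if \<open>a\<close> and
  \<open>b\<close> are proportional, where \<open>cross a b\<close> would be no witness.\<close>

lemma common_orthogonal:
  fixes a b :: "'a::field ^ 3"
  shows "\<exists>s. s \<noteq> 0 \<and> dot3 a s = 0 \<and> dot3 b s = 0"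
proof -
  have "det (vector [a, b, 0] :: 'a ^ 3 ^ 3) = 0"
    by (simp add: det_3)
  then obtain s where "s \<noteq> 0" "(vector [a, b, 0] :: 'a ^ 3 ^ 3) *v s = 0"
    using invertible_det_nz invertible_left_inverse matrix_left_invertible_ker by metis
  then show ?thesis
    by (auto simp: vec_eq_iff forall_3 matrix_vector_mult_def sum_3 dot3_expand)
qed

section \<open>Bilinear forms and line pairs\<close>

definition bilin :: "'a::field ^ 3 ^ 3 \<Rightarrow> 'a ^ 3 \<Rightarrow> 'a ^ 3 \<Rightarrow> 'a" where
  "bilin M x y = dot3 x (M *v y)"

lemma bilin_add_left: "bilin M (x + y) z = bilin M x z + bilin M y z"
  by (simp add: bilin_def dot3_add_left)

lemma bilin_add_right: "bilin M x (y + z) = bilin M x y + bilin M x z"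
  by (simp add: bilin_def matrix_vector_right_distrib dot3_add_right)

lemma bilin_scale_left: "bilin M (c *s x) y = c * bilin M x y"
  by (simp add: bilin_def dot3_scale_left)

lemma bilin_scale_right: "bilin M x (c *s y) = c * bilin M x y"
  by (simp add: bilin_def vector_scalar_commute dot3_scale_right)

lemmas bilin_simps = bilin_add_left bilin_add_right bilin_scale_left bilin_scale_right

lemma bilin_expand:
  "bilin M x y = x$1 * (M$1$1 * y$1 + M$1$2 * y$2 + M$1$3 * y$3)
     + x$2 * (M$2$1 * y$1 + M$2$2 * y$2 + M$2$3 * y$3)
     + x$3 * (M$3$1 * y$1 + M$3$2 * y$2 + M$3$3 * y$3)"
  by (simp add: bilin_def dot3_expand matrix_vector_mult_def sum_3)

lemma bilin_commute:
  assumes "transpose M = M"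
  shows "bilin M x y = bilin M y x"
proof -
  have "transpose M $ m $ n = M $ n $ m" for m n
    by (simp add: transpose_def)
  then have "M$2$1 = M$1$2" "M$3$1 = M$1$3" "M$3$2 = M$2$3"
    unfolding assms by auto
  then show ?thesis
    by (simp add: bilin_expand algebra_simps)
qed

lemma bilin_matrix_add: "bilin (M + N) x y = bilin M x y + bilin N x y"
  by (simp add: bilin_expand algebra_simps)

lemma bilin_lincomb:
  "bilin (\<chi> i j. c * M$i$j + d * N$i$j) x y = c * bilin M x y + d * bilin N x y"
  by (simp add: bilin_expand algebra_simps)

lemma bilin_zero [simp]: "bilin 0 x y = 0"
  by (simp add: bilin_expand)

text \<open>The Gram determinant of \<open>u, v, x\<close> is \<open>det M * (det [u, v, x])^2\<close>; the hypotheses that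
  \<open>u\<close> and \<open>v\<close> are isotropic turn it into the equation of a pencil of bitangent conics.\<close>

lemma bitangent_pencil:
  assumes "transpose M = M" "bilin M u u = 0" "bilin M v v = 0"
  shows "2 * bilin M u v * bilin M x u * bilin M x v
    = (bilin M u v)^2 * bilin M x x + det M * (dot3 (cross u v) x)^2"
proof -
  let ?N = "vector [u, v, x] :: 'a ^ 3 ^ 3"
  let ?G = "?N ** M ** transpose ?N"
  have N: "?N $ 1 = u" "?N $ 2 = v" "?N $ 3 = x" by simp_all
  have G: "?G $ i $ j = bilin M (?N $ i) (?N $ j)" for i j
    unfolding bilin_expand
    by (simp add: matrix_matrix_mult_def transpose_def sum_3 algebra_simps)
  have "det ?N = dot3 (cross u v) x"
    by (simp add: det_3 dot3_expand cross_def algebra_simps)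
  then have "det ?G = det M * (dot3 (cross u v) x)^2"
    by (simp add: det_mul det_transpose power2_eq_square)
  moreover have "det ?G = 2 * bilin M u v * bilin M x u * bilin M x v
      - (bilin M u v)^2 * bilin M x x"
    unfolding det_3 G N using assms
    by (simp add: bilin_commute[OF assms(1), of v u] bilin_commute[OF assms(1), of u x]
        bilin_commute[OF assms(1), of v x] power2_eq_square algebra_simps)
  ultimately show ?thesis by (simp add: diff_eq_eq)
qed

text \<open>Matrix of the line pair \<open>a\<close>, \<open>b\<close>, scaled to avoid halves: its
  quadratic form is twice the product of the two linear forms.\<close>

definition symprod :: "'a::field ^ 3 \<Rightarrow> 'a ^ 3 \<Rightarrow> 'a ^ 3 ^ 3" where
  "symprod a b = (\<chi> i j. a$i * b$j + b$i * a$j)"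

lemma bilin_symprod: "bilin (symprod a b) x y = dot3 a x * dot3 b y + dot3 b x * dot3 a y"
  by (simp add: bilin_expand dot3_expand symprod_def algebra_simps)

section \<open>Conics and lines in homogeneous coordinates\<close>

lemma proportional_refl: "x \<noteq> 0 \<Longrightarrow> proportional x x"
  unfolding proportional_def by (auto intro!: exI[of _ 1])

lemma ppoint_rep:
  obtains x where "x \<noteq> 0" "A = abs_ppoint x"
  by (metis Quotient3_ppoint Quotient3_def proportional_def)

lemma on_line_abs: "x \<noteq> 0 \<Longrightarrow> on_line a (abs_ppoint x) \<longleftrightarrow> dot3 a x = 0"
  by (simp add: on_line.abs_eq proportional_refl)

lemma conjugate_abs:
  "x \<noteq> 0 \<Longrightarrow> y \<noteq> 0 \<Longrightarrow> conjugate M (abs_ppoint x) (abs_ppoint y) \<longleftrightarrow> bilin M x y = 0"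
  by (simp add: conjugate.abs_eq proportional_refl bilin_def)

lemma conic_points_abs:
  "x \<noteq> 0 \<Longrightarrow> abs_ppoint x \<in> conic_points M \<longleftrightarrow> bilin M x x = 0"
  by (simp add: conic_points_def conjugate_abs)

lemma cross_neq_0:
  assumes "x \<noteq> 0" "y \<noteq> 0" "abs_ppoint x \<noteq> abs_ppoint y"
  shows "cross x y \<noteq> 0"
proof
  assume "cross x y = 0"
  then obtain c where "y = c *s x"
    using cross_eq_0_imp_multiple assms by blast
  with assms have "proportional x y"
    unfolding proportional_def by auto
  then have "abs_ppoint x = abs_ppoint y"
    using Quotient3_rel[OF Quotient3_ppoint] by blast
  with assms show False by simp
qed

lemma cross_neq_0_imp_distinct:
  assumes "cross x y \<noteq> 0"
  shows "abs_ppoint x \<noteq> abs_ppoint y"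
proof
  have ne: "x \<noteq> 0" "y \<noteq> 0"
    using assms by (auto simp: cross_def vec_eq_iff forall_3)
  assume "abs_ppoint x = abs_ppoint y"
  then have "proportional x y"
    using Quotient3_rel[OF Quotient3_ppoint, of x y] ne proportional_refl by blast
  then obtain c where "y = c *s x"
    by (auto simp: proportional_def)
  with assms show False
    by (auto simp: cross_def vec_eq_iff forall_3 algebra_simps)
qed

text \<open>The second point is taken on an auxiliary line \<open>e\<close> that misses
  \<open>u\<close>, so it is no multiple of \<open>u\<close>.\<close>

lemma line_through_two:
  fixes a :: "'a::field ^ 3"
  obtains u v where "cross u v \<noteq> 0" "dot3 a u = 0" "dot3 a v = 0"
proof -
  obtain u where u: "u \<noteq> 0" "dot3 a u = 0"
    using common_orthogonal by blast
  obtain e where e: "dot3 u e \<noteq> 0"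
    using dot3_nondegenerate u by blast
  obtain v where v: "v \<noteq> 0" "dot3 a v = 0" "dot3 e v = 0"
    using common_orthogonal by blast
  have "cross u v \<noteq> 0"
  proof
    assume "cross u v = 0"
    then obtain c where "v = c *s u"
      using cross_eq_0_imp_multiple u by blast
    with v e show False
      by (auto simp: dot3_scale_right dot3_commute)
  qed
  with u v that show thesis by blast
qed

text \<open>The points \<open>u + n v\<close> are pairwise distinct, since in characteristic zero
  the factor \<open>n - m\<close> of their cross product is nonzero.\<close>

lemma infinite_line:
  fixes L :: "'a::field_char_0 ppoint set"
  assumes "is_line L"
  shows "infinite L"
proof -
  obtain a where a: "a \<noteq> 0" "L = {P. on_line a P}"
    using assms by (auto simp: is_line_def)
  obtain u v where uv: "cross u v \<noteq> 0" "dot3 a u = 0" "dot3 a v = 0"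
    using line_through_two by blast
  let ?f = "\<lambda>n::nat. u + of_nat n *s v"
  have cr: "cross (?f m) (?f n) = (of_nat n - of_nat m) *s cross u v" for m n
    by (simp add: cross_def vec_eq_iff forall_3 algebra_simps)
  have "inj (\<lambda>n. abs_ppoint (?f n))"
  proof (rule injI, rule ccontr)
    fix m n :: nat
    assume "abs_ppoint (?f m) = abs_ppoint (?f n)" "m \<noteq> n"
    moreover from this have "cross (?f m) (?f n) \<noteq> 0"
      using cr uv by simp
    ultimately show False
      using cross_neq_0_imp_distinct by blast
  qed
  moreover have "range (\<lambda>n. abs_ppoint (?f n)) \<subseteq> L"
  proof (intro image_subsetI)
    fix n
    have "cross (?f n) v = cross u v"
      by (simp add: cross_def vec_eq_iff forall_3 algebra_simps)
    with uv have "?f n \<noteq> 0"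
      by (auto simp: cross_def vec_eq_iff forall_3)
    then show "abs_ppoint (?f n) \<in> L"
      using a uv by (simp add: on_line_abs dot3_add_right dot3_scale_right)
  qed
  ultimately show ?thesis
    using infinite_super range_inj_infinite by blast
qed

lemma bilin_vanishes_on_span:
  assumes "transpose M = M" "bilin M u u = 0" "bilin M v v = 0" "bilin M u v = 0"
  shows "bilin M (s *s u + t *s v) (s *s u + t *s v) = 0"
  using assms bilin_commute[OF assms(1), of v u] by (simp add: bilin_simps)

lemma bilin_vanishes_on_line:
  assumes "transpose M = M" "bilin M u u = 0" "bilin M v v = 0" "bilin M u v = 0"
    and "cross u v \<noteq> 0" "a \<noteq> 0" "dot3 a u = 0" "dot3 a v = 0" "dot3 a x = 0"
  shows "bilin M x x = 0"
  using orthogonal_imp_span[OF assms(5-9)] bilin_vanishes_on_span[OF assms(1-4)] by blast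

lemma line_subset_conic_points:
  assumes "transpose M = M" "bilin M u u = 0" "bilin M v v = 0" "bilin M u v = 0"
    and "cross u v \<noteq> 0" "a \<noteq> 0" "dot3 a u = 0" "dot3 a v = 0"
  shows "{P. on_line a P} \<subseteq> conic_points M"
proof
  fix Z assume Z: "Z \<in> {P. on_line a P}"
  obtain z where z: "z \<noteq> 0" "Z = abs_ppoint z"
    by (rule ppoint_rep)
  with Z have "dot3 a z = 0"
    by (simp add: on_line_abs)
  with z show "Z \<in> conic_points M"
    using bilin_vanishes_on_line[OF assms] by (simp add: conic_points_abs)
qed

text \<open>A binary quadratic form with three distinct zeros is zero: in the basis
  \<open>u\<close>, \<open>v\<close> only the mixed term is left, and both coordinates of
  \<open>w\<close> are nonzero.\<close>

lemma three_points_line_subset_conic_points: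
  fixes M :: "'a::field_char_0 ^ 3 ^ 3"
  assumes M: "transpose M = M" "bilin M u u = 0" "bilin M v v = 0" "bilin M w w = 0"
    and ne: "cross u v \<noteq> 0" "cross u w \<noteq> 0" "cross v w \<noteq> 0"
    and a: "a \<noteq> 0" "dot3 a u = 0" "dot3 a v = 0" "dot3 a w = 0"
  shows "{P. on_line a P} \<subseteq> conic_points M"
proof -
  obtain s t where w: "w = s *s u + t *s v"
    using orthogonal_imp_span ne a by metis
  have "cross u w = t *s cross u v" "cross v w = (- s) *s cross u v"
    unfolding w by (simp_all add: cross_def vec_eq_iff forall_3 algebra_simps)
  with ne have "s \<noteq> 0" "t \<noteq> 0" by auto
  moreover have "bilin M w w = 2 * s * t * bilin M u v"
    unfolding w using M bilin_commute[OF M(1), of v u] by (simp add: bilin_simps)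
  ultimately have "bilin M u v = 0"
    using M by simp
  then show ?thesis
    using line_subset_conic_points M ne a by metis
qed

text \<open>Polarizing \<open>c a b + d l^2\<close> at a common zero \<open>s\<close> of
  \<open>a\<close> and \<open>l\<close> leaves only a multiple of \<open>a\<close>. This gives the
  contact of the final conic with each of its two lines.\<close>

lemma tangent_at_symprod:
  assumes "a \<noteq> 0" "s \<noteq> 0" "dot3 a s = 0" "dot3 l s = 0"
  shows "tangent_at (symprod (c *s a) b + symprod (d *s l) l) {P. on_line a P} (abs_ppoint s)"
  unfolding tangent_at_def
proof (intro conjI ballI)
  show "is_line {P. on_line a P}"
    using assms by (auto simp: is_line_def)
  show "abs_ppoint s \<in> {P. on_line a P}"
    using assms by (simp add: on_line_abs)
  fix Z assume Z: "Z \<in> {P. on_line a P}"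
  obtain z where z: "z \<noteq> 0" "Z = abs_ppoint z"
    by (rule ppoint_rep)
  with Z have "dot3 a z = 0"
    by (simp add: on_line_abs)
  with z assms show "conjugate (symprod (c *s a) b + symprod (d *s l) l) Z (abs_ppoint s)"
    by (simp add: conjugate_abs bilin_matrix_add bilin_symprod dot3_scale_left)
qed

text \<open>Tangency makes the linear form \<open>M *v x\<close> vanish on \<open>L\<close>, and
  smoothness makes it nonzero, so it is a coefficient vector of \<open>L\<close>.\<close>

lemma tangent_at_smooth:
  assumes M: "transpose M = M" and x: "x \<noteq> 0"
    and smooth: "smooth_point M (abs_ppoint x)" and tan: "tangent_at M L (abs_ppoint x)"
  shows "M *v x \<noteq> 0" and "L = {P. on_line (M *v x) P}"
proof -
  obtain Z where Z: "\<not> conjugate M Z (abs_ppoint x)"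
    using smooth by (auto simp: smooth_point_def)
  obtain z where z: "z \<noteq> 0" "Z = abs_ppoint z"
    by (rule ppoint_rep)
  show ne: "M *v x \<noteq> 0"
    using Z z x by (auto simp: conjugate_abs bilin_def)
  obtain a where a: "a \<noteq> 0" "L = {P. on_line a P}"
    using tan by (auto simp: tangent_at_def is_line_def)
  obtain u v where uv: "cross u v \<noteq> 0" "dot3 a u = 0" "dot3 a v = 0"
    using line_through_two by blast
  then have uv0: "u \<noteq> 0" "v \<noteq> 0"
    by (auto simp: cross_def vec_eq_iff forall_3)
  have "dot3 (M *v x) w = 0" if "w \<noteq> 0" "dot3 a w = 0" for w
  proof -
    have "conjugate M (abs_ppoint w) (abs_ppoint x)"
      using tan that a by (simp add: tangent_at_def on_line_abs)
    then show ?thesis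
      using that x by (simp add: conjugate_abs bilin_def dot3_commute)
  qed
  then obtain c where c: "M *v x = c *s a"
    using orthogonal_imp_multiple[OF uv(1) a(1)] uv uv0 by blast
  with ne have "c \<noteq> 0" by auto
  have "on_line a P \<longleftrightarrow> on_line (M *v x) P" for P
  proof -
    obtain y where "y \<noteq> 0" "P = abs_ppoint y"
      by (rule ppoint_rep)
    then show ?thesis
      using c \<open>c \<noteq> 0\<close> by (simp add: on_line_abs dot3_scale_left)
  qed
  with a show "L = {P. on_line (M *v x) P}"
    by simp
qed

text \<open>A conic containing the line \<open>a\<close> splits off \<open>a\<close> as a factor;
  the zeros \<open>u\<close> and \<open>v\<close> off \<open>a\<close> force the other factor to be
  a multiple of \<open>b\<close>.\<close>

lemma conic_containing_line:
  fixes M :: "'a::field ^ 3 ^ 3"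
  assumes M: "transpose M = M"
    and line: "\<And>y. dot3 a y = 0 \<Longrightarrow> bilin M y y = 0"
    and uv: "bilin M u u = 0" "bilin M v v = 0" "cross u v \<noteq> 0" "dot3 a u \<noteq> 0" "dot3 a v \<noteq> 0"
    and b: "b \<noteq> 0" "dot3 b u = 0" "dot3 b v = 0"
  shows "\<exists>k. \<forall>x. bilin M x x = k * dot3 a x * dot3 b x"
proof -
  have split: "dot3 a u * bilin M x x = 2 * dot3 a x * bilin M x u" for x
  proof -
    \<comment> \<open>A combination of \<open>x\<close> and \<open>u\<close> lying on
      \<open>a\<close>, where the form vanishes; expanding and cancelling \<open>dot3 a u\<close>
      gives the splitting.\<close>
    let ?y = "dot3 a u *s x + (- dot3 a x) *s u"
    have "dot3 a ?y = 0"
      unfolding dot3_add_right dot3_scale_right by simp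
    then have "bilin M ?y ?y = 0"
      by (rule line)
    then have "dot3 a u * (dot3 a u * bilin M x x - 2 * dot3 a x * bilin M x u) = 0"
      unfolding bilin_simps using uv bilin_commute[OF M, of u x] by (simp add: algebra_simps)
    with uv show ?thesis by simp
  qed
  have polar: "bilin M x u = dot3 (M *v u) x" for x
    by (simp add: bilin_def dot3_commute)
  have "\<exists>k. \<forall>x. 2 * bilin M x u = k * dot3 b x"
  proof (cases "(2::'a) = 0")
    case True
    then show ?thesis by (intro exI[of _ 0]) simp
  next
    case False
    \<comment> \<open>Hence the polar form of \<open>u\<close> vanishes at both \<open>u\<close> and
      \<open>v\<close>, as \<open>b\<close> does.\<close>
    with split[of v] uv have "bilin M v u = 0" by auto
    then obtain c where "M *v u = c *s b"
      using orthogonal_imp_multiple[OF uv(3) b] uv polar by metis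
    then show ?thesis
      by (intro exI[of _ "2 * c"]) (simp add: polar dot3_scale_left)
  qed
  then obtain k where "\<And>x. 2 * bilin M x u = k * dot3 b x"
    by blast
  then have "bilin M x x = k / dot3 a u * dot3 a x * dot3 b x" for x
    using split[of x] uv by (simp add: field_simps)
  then show ?thesis by blast
qed

theorem theorem6:
  fixes X R :: "'a::real_normed_field ^ 3 ^ 3"
    and I J p q :: "'a ppoint set"
    and A1 A2 A3 A4 P Q B1 B2 B3 B4 :: "'a ppoint"
  assumes "is_conic X" and "is_conic R"
    and "conic_points X \<inter> conic_points R = {A1, A2, A3, A4}"
    and "distinct [A1, A2, A3, A4]"
    and "is_line I" and "A1 \<in> I" and "A2 \<in> I"
    and "is_line J" and "A3 \<in> J" and "A4 \<in> J"
    and "P \<noteq> Q"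
    and "smooth_point R P" and "tangent_at R p P"
    and "smooth_point R Q" and "tangent_at R q Q"
    and "p \<inter> conic_points X = {B1, B2}"
    and "q \<inter> conic_points X = {B3, B4}"
    and "distinct [B1, B2, B3, B4]"
  shows "\<exists>C. is_conic C \<and> {B1, B2, B3, B4} \<subseteq> conic_points C \<and>
    (\<exists>S T. tangent_at C I S \<and> tangent_at C J T \<and> pcollinear {S, T, P, Q})"
proof -

  \<comment> \<open>Coordinates for the points and lines\<close>
  have X: "transpose X = X" and R: "transpose R = R"
    using assms by (auto simp: is_conic_def)
  obtain a1 a2 a3 a4 where a0: "a1 \<noteq> 0" "a2 \<noteq> 0" "a3 \<noteq> 0" "a4 \<noteq> 0"
    and A: "A1 = abs_ppoint a1" "A2 = abs_ppoint a2" "A3 = abs_ppoint a3" "A4 = abs_ppoint a4"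
    by (metis ppoint_rep)
  obtain b1 b2 b3 b4 where b0: "b1 \<noteq> 0" "b2 \<noteq> 0" "b3 \<noteq> 0" "b4 \<noteq> 0"
    and B: "B1 = abs_ppoint b1" "B2 = abs_ppoint b2" "B3 = abs_ppoint b3" "B4 = abs_ppoint b4"
    by (metis ppoint_rep)
  obtain u v where uv0: "u \<noteq> 0" "v \<noteq> 0" and PQ: "P = abs_ppoint u" "Q = abs_ppoint v"
    by (metis ppoint_rep)
  obtain i where i: "i \<noteq> 0" and I: "I = {Z. on_line i Z}"
    using assms by (auto simp: is_line_def)
  obtain j where j: "j \<noteq> 0" and J: "J = {Z. on_line j Z}"
    using assms by (auto simp: is_line_def)

  have "{A1, A2, A3, A4} \<subseteq> conic_points X" "{A1, A2, A3, A4} \<subseteq> conic_points R"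
    using assms(3) by blast+
  then have Xa: "bilin X a1 a1 = 0" "bilin X a2 a2 = 0" "bilin X a3 a3 = 0" "bilin X a4 a4 = 0"
    and Ra: "bilin R a1 a1 = 0" "bilin R a2 a2 = 0" "bilin R a3 a3 = 0" "bilin R a4 a4 = 0"
    by (simp_all add: A a0 conic_points_abs)
  have ia: "dot3 i a1 = 0" "dot3 i a2 = 0" and ja: "dot3 j a3 = 0" "dot3 j a4 = 0"
    using assms(6,7,9,10) by (simp_all add: A I J a0 on_line_abs)
  have A_neq: "A1 \<noteq> A2" "A1 \<noteq> A3" "A1 \<noteq> A4" "A2 \<noteq> A3" "A2 \<noteq> A4"
      "A3 \<noteq> A4" "A3 \<noteq> A1" "A4 \<noteq> A1"
    using assms(4) by auto
  have a_neq: "cross a1 a2 \<noteq> 0" "cross a1 a3 \<noteq> 0" "cross a1 a4 \<noteq> 0" "cross a2 a3 \<noteq> 0"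
    "cross a2 a4 \<noteq> 0" "cross a3 a4 \<noteq> 0" "cross a3 a1 \<noteq> 0" "cross a4 a1 \<noteq> 0"
    using A_neq a0 unfolding A by (simp_all add: cross_neq_0)

  \<comment> \<open>General position of the four common points\<close>
  have no_line: False if "a \<noteq> 0" "{Z. on_line a Z} \<subseteq> conic_points X"
    "{Z. on_line a Z} \<subseteq> conic_points R" for a
  proof -
    have "infinite {Z. on_line a Z}"
      using that by (intro infinite_line) (auto simp: is_line_def)
    moreover have "{Z. on_line a Z} \<subseteq> {A1, A2, A3, A4}"
      using that assms(3) by blast
    ultimately show False
      using finite_subset by blast
  qed
  \<comment> \<open>Three distinct collinear common points would put a whole line into both conics,
    which share only four points.\<close>
  have no_triple: False if "bilin X x x = 0" "bilin X y y = 0" "bilin X z z = 0"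
    "bilin R x x = 0" "bilin R y y = 0" "bilin R z z = 0"
    "cross x y \<noteq> 0" "cross x z \<noteq> 0" "cross y z \<noteq> 0"
    "a \<noteq> 0" "dot3 a x = 0" "dot3 a y = 0" "dot3 a z = 0" for a x y z
    using no_line three_points_line_subset_conic_points X R that by metis
  have ia3: "dot3 i a3 \<noteq> 0"
    using no_triple[of a1 a2 a3 i] Xa Ra a_neq i ia by blast
  have ia4: "dot3 i a4 \<noteq> 0"
    using no_triple[of a1 a2 a4 i] Xa Ra a_neq i ia by blast
  have ja1: "dot3 j a1 \<noteq> 0"
    using no_triple[of a3 a4 a1 j] Xa Ra a_neq j ja by blast

  \<comment> \<open>The tangents at P and Q\<close>
  have Ru: "R *v u \<noteq> 0" "p = {Z. on_line (R *v u) Z}"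
    using tangent_at_smooth[OF R] uv0 assms(12,13) PQ by blast+
  have Rv: "R *v v \<noteq> 0" "q = {Z. on_line (R *v v) Z}"
    using tangent_at_smooth[OF R] uv0 assms(14,15) PQ by blast+
  have polar: "bilin R x y = dot3 (R *v y) x" for x y
    by (simp add: bilin_def dot3_commute)
  have Ruu: "bilin R u u = 0" "bilin R v v = 0"
    using assms(12,14) by (simp_all add: smooth_point_def PQ uv0 conic_points_abs)
  have uv: "cross u v \<noteq> 0"
    using assms(11) uv0 by (simp add: PQ cross_neq_0)
  have "{B1, B2} \<subseteq> p" "{B3, B4} \<subseteq> q" "{B1, B2, B3, B4} \<subseteq> conic_points X"
    using assms(16,17) by blast+
  then have Rb: "bilin R b1 u = 0" "bilin R b2 u = 0" "bilin R b3 v = 0" "bilin R b4 v = 0"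
    and Xb: "bilin X b1 b1 = 0" "bilin X b2 b2 = 0" "bilin X b3 b3 = 0" "bilin X b4 b4 = 0"
    unfolding Ru Rv by (simp_all add: B b0 on_line_abs polar conic_points_abs)

  have not_p_X: "\<not> p \<subseteq> conic_points X"
  proof
    assume "p \<subseteq> conic_points X"
    then have "p = {B1, B2}"
      using assms(16) by blast
    moreover have "infinite p"
      using assms(13) by (intro infinite_line) (simp add: tangent_at_def)
    ultimately show False by simp
  qed

  define r where "r = bilin R u v"
  have r: "r \<noteq> 0"
  \<comment> \<open>Otherwise the polars of \<open>u\<close> and \<open>v\<close> both pass through
    \<open>u\<close> and \<open>v\<close>, so the tangents coincide and \<open>B1\<close> would also
    be one of \<open>B3\<close>, \<open>B4\<close>.\<close>
  proof
    assume "r = 0"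
    then have "bilin R u v = 0" "bilin R v u = 0"
      using bilin_commute[OF R, of u v] by (simp_all add: r_def)
    then obtain c where c: "R *v v = c *s (R *v u)"
      using orthogonal_imp_multiple[OF uv Ru(1), of "R *v v"] Ruu by (auto simp: polar)
    then have "dot3 (R *v v) b1 = 0"
      using Rb by (simp add: dot3_scale_left polar)
    then have "B1 \<in> q"
      by (simp add: Rv B b0 on_line_abs)
    then have "B1 \<in> {B3, B4}"
      using assms(16,17) by blast
    with assms(18) show False by auto
  qed

  \<comment> \<open>The line pair I, J in the pencil of X and R\<close>
  define \<alpha> \<beta> where "\<alpha> = bilin R a1 a2" and "\<beta> = - bilin X a1 a2"
  have \<alpha>\<beta>: "\<alpha> \<noteq> 0 \<or> \<beta> \<noteq> 0"
  proof (rule ccontr)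
    assume "\<not> ?thesis"
    then have "bilin R a1 a2 = 0" "bilin X a1 a2 = 0"
      by (simp_all add: \<alpha>_def \<beta>_def)
    then show False
      using no_line[OF i] line_subset_conic_points X R Xa Ra a_neq(1) i ia by metis
  qed
  \<comment> \<open>\<alpha> and \<beta> are chosen to make \<open>a1\<close> and \<open>a2\<close>
    conjugate for \<open>M\<close>; both are isotropic, so \<open>M\<close> contains all of
    \<open>I\<close>. As it also passes through \<open>a3\<close> and \<open>a4\<close>, its other
    factor is \<open>j\<close>.\<close>
  define M where "M = (\<chi> m n. \<alpha> * X$m$n + \<beta> * R$m$n)"
  have bilin_M: "bilin M x y = \<alpha> * bilin X x y + \<beta> * bilin R x y" for x y
    unfolding M_def by (rule bilin_lincomb)
  have M: "transpose M = M"
    using X R by (simp add: M_def transpose_def vec_eq_iff)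
  have "bilin M a1 a2 = 0"
    unfolding bilin_M by (simp add: \<alpha>_def \<beta>_def)
  then have "bilin M y y = 0" if "dot3 i y = 0" for y
    using bilin_vanishes_on_line[OF M _ _ _ a_neq(1) i ia that] Xa Ra by (simp add: bilin_M)
  then obtain k where "\<And>x. bilin M x x = k * dot3 i x * dot3 j x"
    using conic_containing_line[OF M, of i a3 a4 j] Xa Ra a_neq(6) ia3 ia4 j ja
    by (auto simp: bilin_M)
  then have k: "\<alpha> * bilin X x x + \<beta> * bilin R x x = k * dot3 i x * dot3 j x" for x
    by (simp add: bilin_M)
  \<comment> \<open>If \<open>k = 0\<close>, the forms of \<open>X\<close> and \<open>R\<close> are
    linearly dependent. Either the form of \<open>R\<close> vanishes, against smoothness at
    \<open>P\<close>, or \<open>p\<close> would lie entirely on \<open>X\<close>.\<close>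
  have "k \<noteq> 0"
  proof
    assume "k = 0"
    with k have dep: "\<alpha> * bilin X x x + \<beta> * bilin R x x = 0" for x
      by simp
    show False
    proof (cases "\<alpha> = 0")
      case True
      with dep \<alpha>\<beta> have R0: "bilin R x x = 0" for x
        by auto
      have "bilin R x u = 0" for x
      proof -
        have "bilin R (x + u) (x + u) = 2 * bilin R x u"
          using R0 bilin_commute[OF R, of u x] by (simp add: bilin_simps)
        with R0 show ?thesis by simp
      qed
      with Ru(1) show False
        using dot3_nondegenerate by (auto simp: polar)
    next
      case False
      have X_R: "conic_points R \<subseteq> conic_points X"
      proof
        fix Z assume Z: "Z \<in> conic_points R"
        obtain z where "z \<noteq> 0" "Z = abs_ppoint z"
          by (rule ppoint_rep)
        with Z dep[of z] False show "Z \<in> conic_points X"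
          by (simp add: conic_points_abs)
      qed
      \<comment> \<open>One of \<open>B1\<close>, \<open>B2\<close> differs from \<open>P\<close>.
        If \<beta> is nonzero, dependence puts it on \<open>R\<close>; being conjugate to
        \<open>P\<close>, it forces the whole tangent \<open>p\<close> into \<open>R\<close> and
        hence into \<open>X\<close>.\<close>
      have "\<exists>b. cross b u \<noteq> 0 \<and> bilin X b b = 0 \<and> bilin R b u = 0"
      proof (cases "B1 = P")
        case True
        with assms(18) have "B2 \<noteq> P" by auto
        then show ?thesis
          using Xb Rb b0 uv0 by (intro exI[of _ b2]) (simp add: B PQ cross_neq_0)
      next
        case False
        then show ?thesis
          using Xb Rb b0 uv0 by (intro exI[of _ b1]) (simp add: B PQ cross_neq_0)
      qed
      then obtain b where b: "cross b u \<noteq> 0" "bilin X b b = 0" "bilin R b u = 0"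
        by blast
      show False
      proof (cases "\<beta> = 0")
        case True
        have "p \<subseteq> conic_points X"
        proof
          fix Z :: "'a ppoint"
          obtain z where "z \<noteq> 0" "Z = abs_ppoint z"
            by (rule ppoint_rep)
          with dep[of z] True False show "Z \<in> conic_points X"
            by (simp add: conic_points_abs)
        qed
        with not_p_X show False ..
      next
        case False
        with dep[of b] b have "bilin R b b = 0" by simp
        then have "p \<subseteq> conic_points R"
          unfolding Ru(2) using b Ru(1) Ruu
          by (intro line_subset_conic_points[OF R, of b u]) (auto simp flip: polar)
        with X_R not_p_X show False by blast
      qed
    qed
  qed

  \<comment> \<open>The conic C and its tangents\<close>
  define l where "l = cross u v"
  define e where "e = \<beta> * det R"
  \<comment> \<open>Its quadratic form is twice \<open>k r^2 I J + \<beta> \<delta> l^2\<close>,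
    with \<open>det R\<close> as \<delta>.\<close>
  define C where "C = symprod ((k * r\<^sup>2) *s i) j + symprod (e *s l) l"
  \<comment> \<open>Exchanging \<open>i\<close> and \<open>j\<close> lets the same tangency lemma
    serve \<open>J\<close>.\<close>
  have C': "C = symprod ((k * r\<^sup>2) *s j) i + symprod (e *s l) l"
    by (simp add: C_def symprod_def vec_eq_iff algebra_simps)
  have bilin_C: "bilin C x y = k * r\<^sup>2 * (dot3 i x * dot3 j y + dot3 j x * dot3 i y)
      + 2 * e * dot3 l x * dot3 l y" for x y
    by (simp add: C_def bilin_matrix_add bilin_symprod dot3_scale_left algebra_simps)
  \<comment> \<open>This form shows the incidences: at each of the four points \<open>X\<close>
    vanishes and so does one of the two tangent forms.\<close>
  have C_pencil: "bilin C x x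
      = 2 * (\<alpha> * r\<^sup>2 * bilin X x x + 2 * \<beta> * r * bilin R x u * bilin R x v)" for x
  proof -
    have "bilin C x x = 2 * (r\<^sup>2 * (k * dot3 i x * dot3 j x) + e * (dot3 l x)\<^sup>2)"
      by (simp add: bilin_C power2_eq_square algebra_simps)
    also have "\<dots> = 2 * (\<alpha> * r\<^sup>2 * bilin X x x + \<beta> * (r\<^sup>2 * bilin R x x + det R * (dot3 l x)\<^sup>2))"
      unfolding k[symmetric] e_def by (simp add: algebra_simps)
    also have "r\<^sup>2 * bilin R x x + det R * (dot3 l x)\<^sup>2 = 2 * r * bilin R x u * bilin R x v"
      using bitangent_pencil[OF R Ruu] by (simp add: r_def l_def)
    finally show ?thesis by (simp add: algebra_simps)
  qed
  have "C \<noteq> 0"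
  proof
    assume "C = 0"
    \<comment> \<open>Since \<open>a1\<close> lies on \<open>I\<close>, the first value gives
      \<open>e * dot3 l a1 = 0\<close>. The second then reduces to \<open>k r^2\<close> times
      \<open>dot3 j a1 * dot3 i a3\<close>, a product of nonzero factors.\<close>
    then have "bilin C a1 a1 = 0" "bilin C a1 a3 = 0" by simp_all
    then have "e * dot3 l a1 = 0" "k * r\<^sup>2 * (dot3 j a1 * dot3 i a3) + 2 * e * dot3 l a1 * dot3 l a3 = 0"
      using ia ja by (simp_all add: bilin_C)
    with \<open>k \<noteq> 0\<close> r ia3 ja1 show False by auto
  qed
  moreover have "transpose C = C"
    by (simp add: C_def transpose_def symprod_def vec_eq_iff algebra_simps)
  ultimately have "is_conic C"
    by (simp add: is_conic_def)
  moreover have "{B1, B2, B3, B4} \<subseteq> conic_points C"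
    using Xb Rb by (simp add: B b0 conic_points_abs C_pencil)
  \<comment> \<open>The touching points are taken where \<open>I\<close> and \<open>J\<close> meet
    \<open>l\<close>, the line through \<open>P\<close> and \<open>Q\<close>, which settles
    collinearity.\<close>
  moreover obtain s where s: "s \<noteq> 0" "dot3 i s = 0" "dot3 l s = 0"
    using common_orthogonal by blast
  moreover obtain t where t: "t \<noteq> 0" "dot3 j t = 0" "dot3 l t = 0"
    using common_orthogonal by blast
  moreover have "tangent_at C I (abs_ppoint s)"
    unfolding I C_def using i s by (rule tangent_at_symprod)
  moreover have "tangent_at C J (abs_ppoint t)"
    unfolding J C' using j t by (rule tangent_at_symprod)
  moreover have "pcollinear {abs_ppoint s, abs_ppoint t, P, Q}"
    unfolding pcollinear_def is_line_def using uv s t uv0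
    by (intro exI[of _ "{Z. on_line l Z}"]) (auto simp: PQ on_line_abs l_def)
  ultimately show ?thesis by blast
qed

end
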